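(* Let $n$ be a positive integer, and let $p$ and $q$ be coprime positive integers satisfying $pq \mid n$. For independent variables $z_i$ ($0 \le i \le n_p - 1$) and $w_j$ ($0 \le j \le n_q - 1$), consider the $\mathbb{C}$-algebra homomorphisms $$\rho : \mathbb{C}[z_i \mid 0 \le i \le n_p-1] \to \mathbb{C}[\Theta_p(\mathbf{y}^{(p)}_i) \mid 0 \le i \le n_p-1], \qquad \rho(z_i) := \Theta_p(\mathbf{y}^{(p)}_i),$$ and $$\rho' : \mathbb{C}[z_i, w_j \mid 0 \le i \le n_p-1,\ 0 \le j \le n_q-1] \to \mathbb{C}[\Theta_p(\mathbf{y}^{(p)}_i), \Theta_q(\mathbf{y}^{(q)}_j) \mid 0 \le i \le n_p-1,\ 0 \le j \le n_q-1],$$ $$\rho'(z_i) := \Theta_p(\mathbf{y}^{(p)}_i), \qquad \rho'(w_j) := \Theta_q(\mathbf{y}^{(q)}_j).$$ Then $$\ker(\rho) = \{0\}, \qquad \ker(\rho') = (t_0, t_1, \ldots, t_{n_{pq}-1}),$$ where $t_i := \prod_{j=0}^{q-1} z_{i + n_{pq} j} - \prod_{j=0}^{p-1} w_{i + n_{pq} j}$ for $0 \le i \le n_{pq}-1$.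
   Context: Let $\mathbf{x} = (x_0, \ldots, x_{n-1})$ be variables and $\mathbb{C}[\mathbf{x}] = \mathbb{C}[x_0,\ldots,x_{n-1}]$ the polynomial ring. For $m \ge 1$ and elements $u_0,\ldots,u_{m-1}$ of a commutative ring, $\Theta_m(u_0,\ldots,u_{m-1})$ denotes the circulant determinant of order $m$, i.e. the determinant of the $m\times m$ matrix whose $(r,s)$ entry ($0 \le r,s \le m-1$) is $u_{(r-s) \bmod m}$. Let $\zeta_n \in \mathbb{C}$ be a primitive $n$-th root of unity. For a positive divisor $d$ of $n$ put $n_d := n/d$, and for $0 \le i \le n_d - 1$ let $\mathbf{y}^{(d)}_i := (y^{(d)}_{i,0}, \ldots, y^{(d)}_{i,d-1})$, where $$y^{(d)}_{i,j} := \sum_{l=0}^{n_d-1} \zeta_n^{i(j+dl)} x_{j+dl} \quad (0 \le j \le d-1).$$ For a family of elements of $\mathbb{C}[\mathbf{x}]$, $\mathbb{C}[\ldots]$ denotes the $\mathbb{C}$-subalgebra of $\mathbb{C}[\mathbf{x}]$ generated by them. $(t_0,\ldots,t_{n_{pq}-1})$ denotes the ideal of $\mathbb{C}[z_i,w_j]$ generated by the $t_i$. *)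

theory Defs
  imports Complex_Main "HOL-Library.Poly_Mapping"
    "HOL-Algebra.Generated_Rings" "HOL-Algebra.RingHom"
    "Jordan_Normal_Form.Determinant"
begin

section \<open>Polynomials over the complex numbers\<close>

text \<open>
  The convolution product on \<open>('v \<Rightarrow>\<^sub>0 nat) \<Rightarrow>\<^sub>0 complex\<close> makes this type the polynomial ring
  in the variables of type \<open>'v\<close>; a monomial is its exponent function.
\<close>

type_synonym 'v mpoly = "('v \<Rightarrow>\<^sub>0 nat) \<Rightarrow>\<^sub>0 complex"

definition mconst :: "complex \<Rightarrow> 'v mpoly" where
  "mconst c = Poly_Mapping.single 0 c"

definition mvar :: "'v \<Rightarrow> 'v mpoly" where
  "mvar v = Poly_Mapping.single (Poly_Mapping.single v 1) 1"

definition poly_ring :: "'v set \<Rightarrow> 'v mpoly ring" where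
  "poly_ring V = \<lparr>carrier = {f. \<forall>m \<in> Poly_Mapping.keys f. Poly_Mapping.keys m \<subseteq> V},
     monoid.mult = (*), one = 1, zero = 0, add = (+)\<rparr>"

text \<open>The \<open>\<complex>\<close>-subalgebra \<open>\<complex>[F]\<close> generated by a family \<open>F\<close> of polynomials in the variables \<open>V\<close>.\<close>

definition subalgebra_gen :: "'v set \<Rightarrow> 'v mpoly set \<Rightarrow> 'v mpoly ring" where
  "subalgebra_gen V F =
     (poly_ring V)\<lparr>carrier := generate_ring (poly_ring V) (range mconst \<union> F)\<rparr>"

text \<open>The substitution homomorphism sending each variable \<open>v\<close> to \<open>g v\<close>.\<close>

definition subst_monom :: "('v \<Rightarrow> 'w mpoly) \<Rightarrow> ('v \<Rightarrow>\<^sub>0 nat) \<Rightarrow> 'w mpoly" where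
  "subst_monom g m = (\<Prod>v \<in> Poly_Mapping.keys m. g v ^ Poly_Mapping.lookup m v)"

definition mpoly_subst :: "('v \<Rightarrow> 'w mpoly) \<Rightarrow> 'v mpoly \<Rightarrow> 'w mpoly" where
  "mpoly_subst g f =
     (\<Sum>m \<in> Poly_Mapping.keys f. mconst (Poly_Mapping.lookup f m) * subst_monom g m)"


section \<open>Circulant determinants of discrete Fourier type forms\<close>

definition circulant_det :: "nat \<Rightarrow> (nat \<Rightarrow> 'a) \<Rightarrow> 'a :: comm_ring_1" where
  "circulant_det m u = det (mat m m (\<lambda>(r, s). u (nat ((int r - int s) mod int m))))"

definition primitive_root_of_unity :: "nat \<Rightarrow> complex \<Rightarrow> bool" where
  "primitive_root_of_unity n \<zeta> \<longleftrightarrow> n > 0 \<and> \<zeta> ^ n = 1 \<and> (\<forall>k. 0 < k \<and> k < n \<longrightarrow> \<zeta> ^ k \<noteq> 1)"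

definition yform :: "nat \<Rightarrow> complex \<Rightarrow> nat \<Rightarrow> nat \<Rightarrow> nat \<Rightarrow> nat mpoly" where
  "yform n \<zeta> d i j = (\<Sum>l<n div d. mconst (\<zeta> ^ (i * (j + d * l))) * mvar (j + d * l))"

definition Theta_y :: "nat \<Rightarrow> complex \<Rightarrow> nat \<Rightarrow> nat \<Rightarrow> nat mpoly" where
  "Theta_y n \<zeta> d i = circulant_det d (yform n \<zeta> d i)"


section \<open>The homomorphisms and the relations\<close>

datatype zw = Z nat | W nat

definition zw_vars :: "nat \<Rightarrow> nat \<Rightarrow> nat \<Rightarrow> zw set" where
  "zw_vars n p q = Z ` {..<n div p} \<union> W ` {..<n div q}"

definition rho_codomain :: "nat \<Rightarrow> complex \<Rightarrow> nat \<Rightarrow> nat mpoly ring" where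
  "rho_codomain n \<zeta> p = subalgebra_gen {..<n} (Theta_y n \<zeta> p ` {..<n div p})"

text \<open>In the domain of \<open>rho\<close> the variable \<open>z\<^sub>i\<close> is \<open>mvar i\<close>.\<close>

definition rho :: "nat \<Rightarrow> complex \<Rightarrow> nat \<Rightarrow> nat mpoly \<Rightarrow> nat mpoly" where
  "rho n \<zeta> p = mpoly_subst (Theta_y n \<zeta> p)"

definition rho'_codomain :: "nat \<Rightarrow> complex \<Rightarrow> nat \<Rightarrow> nat \<Rightarrow> nat mpoly ring" where
  "rho'_codomain n \<zeta> p q =
     subalgebra_gen {..<n} (Theta_y n \<zeta> p ` {..<n div p} \<union> Theta_y n \<zeta> q ` {..<n div q})"

definition rho' :: "nat \<Rightarrow> complex \<Rightarrow> nat \<Rightarrow> nat \<Rightarrow> zw mpoly \<Rightarrow> nat mpoly" where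
  "rho' n \<zeta> p q =
     mpoly_subst (\<lambda>v. case v of Z i \<Rightarrow> Theta_y n \<zeta> p i | W j \<Rightarrow> Theta_y n \<zeta> q j)"

definition trel :: "nat \<Rightarrow> nat \<Rightarrow> nat \<Rightarrow> nat \<Rightarrow> zw mpoly" where
  "trel n p q i = (\<Prod>j<q. mvar (Z (i + n div (p * q) * j))) - (\<Prod>j<p. mvar (W (i + n div (p * q) * j)))"


section \<open>Well-definedness\<close>

lemma mconst_simps [simp]:
  "mconst 0 = 0" "mconst 1 = 1" "mconst (a + b) = mconst a + mconst b"
  "mconst (a * b) = mconst a * mconst b"
  by (simp_all add: mconst_def single_add mult_single)

lemma subst_monom_superset:
  assumes "finite S" "Poly_Mapping.keys m \<subseteq> S"
  shows "subst_monom g m = (\<Prod>v\<in>S. g v ^ Poly_Mapping.lookup m v)"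
  unfolding subst_monom_def using assms
  by (intro prod.mono_neutral_left) (auto simp: in_keys_iff)

lemma subst_monom_add: "subst_monom g (m + m') = subst_monom g m * subst_monom g m'"
proof -
  let ?S = "Poly_Mapping.keys m \<union> Poly_Mapping.keys m'"
  have "Poly_Mapping.keys (m + m') \<subseteq> ?S" by (rule keys_add)
  then show ?thesis
    by (simp add: subst_monom_superset[of ?S] lookup_add power_add prod.distrib)
qed

lemma mpoly_subst_superset:
  assumes "finite S" "Poly_Mapping.keys f \<subseteq> S"
  shows "mpoly_subst g f = (\<Sum>m\<in>S. mconst (Poly_Mapping.lookup f m) * subst_monom g m)"
  unfolding mpoly_subst_def using assms
  by (intro sum.mono_neutral_left) (auto simp: in_keys_iff)

lemma mpoly_subst_add: "mpoly_subst g (f + f') = mpoly_subst g f + mpoly_subst g f'"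
proof -
  let ?S = "Poly_Mapping.keys f \<union> Poly_Mapping.keys f'"
  have "Poly_Mapping.keys (f + f') \<subseteq> ?S" by (rule keys_add)
  then show ?thesis
    by (simp add: mpoly_subst_superset[of ?S] lookup_add distrib_right sum.distrib)
qed

lemma mpoly_subst_zero: "mpoly_subst g 0 = 0"
  by (simp add: mpoly_subst_def)

lemma mpoly_subst_sum: "mpoly_subst g (sum F A) = (\<Sum>a\<in>A. mpoly_subst g (F a))"
  by (induction A rule: infinite_finite_induct) (simp_all add: mpoly_subst_zero mpoly_subst_add)

lemma mpoly_subst_single: "mpoly_subst g (Poly_Mapping.single m c) = mconst c * subst_monom g m"
  by (simp add: mpoly_subst_def)

lemma mpoly_as_sum:
  "f = (\<Sum>m\<in>Poly_Mapping.keys f. Poly_Mapping.single m (Poly_Mapping.lookup f m))"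
  by (rule poly_mapping_eqI)
    (auto simp: lookup_sum lookup_single when_def in_keys_iff)

lemma mpoly_subst_mult: "mpoly_subst g (f * f') = mpoly_subst g f * mpoly_subst g f'"
proof -
  have "f * f' = (\<Sum>m\<in>Poly_Mapping.keys f. \<Sum>m'\<in>Poly_Mapping.keys f'.
      Poly_Mapping.single (m + m') (Poly_Mapping.lookup f m * Poly_Mapping.lookup f' m'))"
    by (subst mpoly_as_sum[of f], subst mpoly_as_sum[of f']) (simp add: sum_product mult_single)
  then show ?thesis
    by (simp add: mpoly_subst_sum mpoly_subst_single subst_monom_add)
       (simp add: mpoly_subst_def sum_product algebra_simps)
qed

lemma mpoly_subst_mconst: "mpoly_subst g (mconst c) = mconst c"
  using mpoly_subst_single[of g 0 c] by (simp add: mconst_def subst_monom_def)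

lemma mpoly_subst_mvar: "mpoly_subst g (mvar v) = g v"
  unfolding mvar_def mpoly_subst_single by (simp add: subst_monom_def)

lemma poly_ring_sel:
  "monoid.mult (poly_ring V) = (*)" "one (poly_ring V) = 1"
  "zero (poly_ring V) = 0" "add (poly_ring V) = (+)"
  "f \<in> carrier (poly_ring V) \<longleftrightarrow>
     (\<forall>m \<in> Poly_Mapping.keys f. Poly_Mapping.keys m \<subseteq> V)"
  by (simp_all add: poly_ring_def)

lemma poly_ring_cring: "cring (poly_ring V)"
proof (intro cringI abelian_groupI comm_monoidI)
  fix x y assume xy: "x \<in> carrier (poly_ring V)" "y \<in> carrier (poly_ring V)"
  show "x \<oplus>\<^bsub>poly_ring V\<^esub> y \<in> carrier (poly_ring V)"
    using xy keys_add[of x y] by (fastforce simp: poly_ring_sel)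
  have "Poly_Mapping.keys m \<subseteq> V" if m: "m \<in> Poly_Mapping.keys (x * y)" for m
  proof -
    obtain a b where "m = a + b" "a \<in> Poly_Mapping.keys x" "b \<in> Poly_Mapping.keys y"
      using m keys_mult[of x y] by auto
    then show ?thesis using xy keys_add[of a b] unfolding poly_ring_sel by blast
  qed
  then show "x \<otimes>\<^bsub>poly_ring V\<^esub> y \<in> carrier (poly_ring V)"
    by (simp add: poly_ring_sel)
next
  fix x assume "x \<in> carrier (poly_ring V)"
  then show "\<exists>y\<in>carrier (poly_ring V). y \<oplus>\<^bsub>poly_ring V\<^esub> x = \<zero>\<^bsub>poly_ring V\<^esub>"
    by (intro bexI[of _ "- x"]) (simp_all add: poly_ring_sel)
qed (auto simp: poly_ring_sel algebra_simps)

lemma mpoly_subst_closed: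
  assumes f: "f \<in> carrier (poly_ring V)" and F: "\<And>v. v \<in> V \<Longrightarrow> g v \<in> F"
  shows "mpoly_subst g f \<in> generate_ring (poly_ring X) (range mconst \<union> F)" (is "_ \<in> ?G")
proof -
  have c: "mconst c \<in> ?G" for c by (auto intro: generate_ring.incl)
  have zero: "0 \<in> ?G" using c[of 0] by simp
  have one: "1 \<in> ?G" using c[of 1] by simp
  have add: "a + b \<in> ?G" if "a \<in> ?G" "b \<in> ?G" for a b
    using generate_ring.eng_add[OF that] by (simp add: poly_ring_sel)
  have mul: "a * b \<in> ?G" if "a \<in> ?G" "b \<in> ?G" for a b
    using generate_ring.eng_mult[OF that] by (simp add: poly_ring_sel)
  have pow: "a ^ k \<in> ?G" if "a \<in> ?G" for a and k :: nat
    by (induction k) (simp_all add: one mul that)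
  have prod: "prod h A \<in> ?G" if "\<And>a. a \<in> A \<Longrightarrow> h a \<in> ?G" for h and A :: "'a set"
    using that by (induction A rule: infinite_finite_induct) (simp_all add: one mul)
  have sum: "sum h A \<in> ?G" if "\<And>a. a \<in> A \<Longrightarrow> h a \<in> ?G" for h and A :: "('a \<Rightarrow>\<^sub>0 nat) set"
    using that by (induction A rule: infinite_finite_induct) (simp_all add: zero add)
  have "g v \<in> ?G" if "v \<in> Poly_Mapping.keys m" "m \<in> Poly_Mapping.keys f" for v m
    using that f F by (auto simp: poly_ring_sel intro!: generate_ring.incl)
  then show ?thesis
    unfolding mpoly_subst_def subst_monom_def by (intro sum mul c prod pow)
qed

lemma mpoly_subst_hom:
  assumes "\<And>v. v \<in> V \<Longrightarrow> g v \<in> F"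
  shows "mpoly_subst g \<in> Ring.ring_hom (poly_ring V) (subalgebra_gen X F)"
  using mpoly_subst_closed[OF _ assms]
  by (auto intro!: ring_hom_memI simp: subalgebra_gen_def poly_ring_sel mpoly_subst_add
      mpoly_subst_mult mpoly_subst_mconst[of g 1, simplified])

lemma rho_hom: "rho n \<zeta> p \<in> Ring.ring_hom (poly_ring {..<n div p}) (rho_codomain n \<zeta> p)"
  unfolding rho_def rho_codomain_def by (rule mpoly_subst_hom) simp

lemma rho_mconst: "rho n \<zeta> p (mconst c) = mconst c"
  by (simp add: rho_def mpoly_subst_mconst)

lemma rho_mvar: "rho n \<zeta> p (mvar i) = Theta_y n \<zeta> p i"
  by (simp add: rho_def mpoly_subst_mvar)

lemma rho'_hom: "rho' n \<zeta> p q \<in> Ring.ring_hom (poly_ring (zw_vars n p q)) (rho'_codomain n \<zeta> p q)"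
  unfolding rho'_def rho'_codomain_def by (rule mpoly_subst_hom) (auto simp: zw_vars_def)

lemma rho'_mconst: "rho' n \<zeta> p q (mconst c) = mconst c"
  by (simp add: rho'_def mpoly_subst_mconst)

lemma rho'_mvar:
  "rho' n \<zeta> p q (mvar (Z i)) = Theta_y n \<zeta> p i"
  "rho' n \<zeta> p q (mvar (W j)) = Theta_y n \<zeta> q j"
  by (simp_all add: rho'_def mpoly_subst_mvar)

end

theory Submission
  imports Defs "HOL-Number_Theory.Cong"
begin

text \<open>
  The Fourier forms \<open>L\<^sub>a = \<Sum>m<n. \<zeta>\<^sup>a\<^sup>m x\<^sub>m\<close>, for \<open>a < n\<close>, are related to the variables by an
  invertible linear substitution, because \<open>\<zeta>\<close> is primitive. Diagonalising the circulant matrix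
  with the Fourier matrix gives \<open>\<Theta>\<^sub>d(y\<^sub>i) = \<Prod>k<d. L (i + (n/d) k)\<close>
  (\<open>Theta_y_eq_prod_fourier_form\<close>): it is the product of the \<open>L\<^sub>a\<close> over one residue class modulo
  \<open>n/d\<close>. In the coordinates \<open>L\<^sub>a\<close> both homomorphisms therefore send variables to monomials
  (\<open>Theta_y_in_fourier_coordinates\<close>), and the theorem becomes one about a toric ideal.

  Classes modulo \<open>n/p\<close> are disjoint, so distinct monomials in the \<open>z\<^sub>i\<close> have distinct images
  and \<open>\<rho>\<close> is injective.

  For \<open>\<rho>'\<close> put \<open>N = n/(pq)\<close>. By the Chinese remainder theorem each residue class modulo \<open>N\<close> is a
  \<open>q\<close> by \<open>p\<close> grid whose rows are the classes modulo \<open>n/p\<close> (the \<open>z\<^sub>i\<close>) and whose columns are the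
  classes modulo \<open>n/q\<close> (the \<open>w\<^sub>j\<close>). The product of all rows equals the product of all columns,
  so every \<open>t\<^sub>c\<close> lies in the kernel (\<open>rho'_trel\<close>). Conversely, modulo the \<open>t\<^sub>c\<close> every monomial
  can be rewritten until, in each grid, some row variable is missing
  (\<open>normal_monom_mod_ideal\<close>). The exponent of \<open>L\<^sub>a\<close> in the image of a monomial is the exponent of
  its row plus that of its column; this array determines both summands once the smallest row
  exponent is known to be 0, so normal monomials have distinct images
  (\<open>inj_on_monom_map_zw_monom\<close>). Hence a polynomial in the kernel is congruent, modulo the
  \<open>t\<^sub>c\<close>, to a combination of normal monomials that maps to 0, and this combination is 0.
\<close>


section \<open>Grouping indices by residue\<close>

lemma (in comm_monoid_set) group_by_residue:
  "F (\<lambda>j. F (\<lambda>l. g (j + d * l)) {..<N}) {..<d} = F g {..<d * N}" for d N :: nat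
proof (cases "d = 0")
  case False
  have "F (\<lambda>j. F (\<lambda>l. g (j + d * l)) {..<N}) {..<d} =
      F (\<lambda>(j, l). g (j + d * l)) ({..<d} \<times> {..<N})"
    by (rule cartesian_product)
  also have "\<dots> = F g {..<d * N}"
  proof (rule reindex_bij_witness[of _ "\<lambda>m. (m mod d, m div d)" "\<lambda>(j, l). j + d * l"])
    fix x assume x: "x \<in> {..<d} \<times> {..<N}"
    then obtain j l where jl: "x = (j, l)" "j < d" "l < N" by auto
    have "j + d * l < d + d * l" using jl by simp
    also have "\<dots> = d * Suc l" by simp
    also have "\<dots> \<le> d * N" using jl by (intro mult_le_mono) auto
    finally show "(case x of (j, l) \<Rightarrow> j + d * l) \<in> {..<d * N}" using jl by simp
  qed (use False in \<open>auto simp: less_mult_imp_div_less mult.commute\<close>)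
  finally show ?thesis .
qed simp


section \<open>The circulant determinant as a product\<close>

text \<open>
  The rows of the Fourier matrix \<open>(\<omega>\<^sup>k\<^sup>r)\<close> are left eigenvectors of the circulant matrix. Over a
  commutative ring the eigenvalues give the determinant as soon as the Fourier matrix is invertible;
  that is ensured by the orthogonality relations and an inverse \<open>e\<close> of \<open>d\<close>.
\<close>

lemma circulant_det_eq_prod:
  fixes u :: "nat \<Rightarrow> 'a :: comm_ring_1" and \<omega> e :: 'a
  assumes root: "\<omega> ^ d = 1"
    and orth: "\<And>t. (\<Sum>j<d. \<omega> ^ (t * j)) = (if d dvd t then of_nat d else 0)"
    and unit: "of_nat d * e = 1"
  shows "circulant_det d u = (\<Prod>k<d. \<Sum>j<d. \<omega> ^ (k * j) * u j)"
proof -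
  define \<Lambda> where "\<Lambda> k = (\<Sum>j<d. \<omega> ^ (k * j) * u j)" for k
  define C where "C = mat d d (\<lambda>(r, s). u (nat ((int r - int s) mod int d)))"
  define F where "F = mat d d (\<lambda>(k, r). \<omega> ^ (k * r))"
  define G where "G = mat d d (\<lambda>(r, k). e * \<omega> ^ ((d - k) * r))"
  have dim: "C \<in> carrier_mat d d" "F \<in> carrier_mat d d" "G \<in> carrier_mat d d"
    by (simp_all add: C_def F_def G_def)
  \<comment> \<open>\<open>\<omega>\<^sup>d\<^sup>-\<^sup>k\<close> stands for the inverse of \<open>\<omega>\<^sup>k\<close>, so \<open>G\<close> is the inverse Fourier matrix.\<close>
  have "F * G = 1\<^sub>m d"
  proof (rule eq_matI)
    fix i k assume "i < dim_row (1\<^sub>m d :: 'a mat)" "k < dim_col (1\<^sub>m d :: 'a mat)"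
    then have ik: "i < d" "k < d" by auto
    have "(F * G) $$ (i, k) = (\<Sum>r<d. \<omega> ^ (i * r) * (e * \<omega> ^ ((d - k) * r)))"
      using ik by (simp add: F_def G_def scalar_prod_def lessThan_atLeast0)
    also have "\<dots> = e * (\<Sum>r<d. \<omega> ^ ((i + (d - k)) * r))"
      by (simp add: sum_distrib_left algebra_simps power_add)
    also have "\<dots> = (if d dvd i + (d - k) then 1 else 0)"
      unfolding orth using unit by (simp add: mult.commute)
    also have "d dvd i + (d - k) \<longleftrightarrow> i = k"
    proof
      assume "d dvd i + (d - k)"
      then obtain c where c: "i + (d - k) = d * c" by (elim dvdE)
      have "0 < d * c" "d * c < d * 2" using c ik by linarith+
      then have "c = 1" by simp
      then show "i = k" using c ik by simp
    qed (use ik in simp)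
    finally show "(F * G) $$ (i, k) = 1\<^sub>m d $$ (i, k)" using ik by simp
  qed (simp_all add: F_def G_def)
  then have FG: "det F * det G = 1"
    using det_mult[OF dim(2,3)] by simp
  \<comment> \<open>Shifting the summation index by \<open>s\<close> modulo \<open>d\<close> multiplies row \<open>k\<close> by \<open>\<omega>\<^sup>k\<^sup>s\<close>.\<close>
  have "F * C = mat_diag d \<Lambda> * F"
  proof (rule eq_matI)
    fix k s assume "k < dim_row (mat_diag d \<Lambda> * F)" "s < dim_col (mat_diag d \<Lambda> * F)"
    then have ks: "k < d" "s < d" by (simp_all add: F_def mat_diag_def)
    have "(F * C) $$ (k, s) = (\<Sum>r<d. \<omega> ^ (k * r) * u (nat ((int r - int s) mod int d)))"
      using ks by (simp add: F_def C_def scalar_prod_def lessThan_atLeast0)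
    also have "\<dots> = (\<Sum>j<d. \<omega> ^ (k * s) * (\<omega> ^ (k * j) * u j))"
    proof (rule sum.reindex_bij_witness[of _ "\<lambda>j. (j + s) mod d"
          "\<lambda>r. nat ((int r - int s) mod int d)"])
      fix j assume "j \<in> {..<d}"
      then have j: "j < d" by simp
      show "nat ((int ((j + s) mod d) - int s) mod int d) = j"
        using j by (simp add: zmod_int mod_diff_left_eq)
      show "(j + s) mod d \<in> {..<d}" using j by simp
    next
      fix r assume "r \<in> {..<d}"
      then have r: "r < d" by simp
      let ?j = "nat ((int r - int s) mod int d)"
      have jint: "int ?j = (int r - int s) mod int d" using r by simp
      show "?j \<in> {..<d}" using r by (simp add: nat_less_iff)
      have "int ((?j + s) mod d) = int r"
        using r by (simp add: zmod_int jint mod_add_left_eq)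
      then show shift: "(?j + s) mod d = r" by simp
      have period: "\<omega> ^ (k * (d * b + a)) = \<omega> ^ (k * a)" for a b
      proof -
        have "k * (d * b + a) = d * (k * b) + k * a" by (simp add: algebra_simps)
        then show ?thesis by (simp only: power_add power_mult[of \<omega> d] root) simp
      qed
      obtain b where "?j + s = d * b + r"
        using shift mult_div_mod_eq[of d "?j + s"] by metis
      then have "\<omega> ^ (k * (?j + s)) = \<omega> ^ (k * r)"
        using period by simp
      then show "\<omega> ^ (k * s) * (\<omega> ^ (k * ?j) * u ?j) = \<omega> ^ (k * r) * u ?j"
        by (simp add: distrib_left power_add mult.assoc[symmetric] mult.commute)
    qed
    also have "\<dots> = \<Lambda> k * F $$ (k, s)"
      using ks by (simp add: F_def \<Lambda>_def sum_distrib_left mult.commute)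
    also have "\<dots> = (mat_diag d \<Lambda> * F) $$ (k, s)"
      unfolding mat_diag_mult_left[OF dim(2)] using ks by simp
    finally show "(F * C) $$ (k, s) = (mat_diag d \<Lambda> * F) $$ (k, s)" .
  qed (simp_all add: F_def C_def mat_diag_def)
  then have "det F * det C = det (mat_diag d \<Lambda>) * det F"
    using dim by (metis det_mult mat_diag_dim)
  then have "det G * (det F * det C) = det G * (det (mat_diag d \<Lambda>) * det F)" by simp
  then have "(det F * det G) * det C = (det F * det G) * det (mat_diag d \<Lambda>)"
    by (simp only: ac_simps)
  then have "det C = det (mat_diag d \<Lambda>)"
    by (simp add: FG)
  also have "\<dots> = (\<Prod>k<d. \<Lambda> k)"
  proof -
    have "det (mat_diag d \<Lambda>) = prod_list (diag_mat (mat_diag d \<Lambda>))"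
      by (rule det_upper_triangular[of _ d]) (auto simp: mat_diag_def)
    then show ?thesis
      by (simp add: prod_list_diag_prod) (simp add: mat_diag_def lessThan_atLeast0)
  qed
  finally show ?thesis by (simp add: circulant_det_def C_def \<Lambda>_def)
qed


section \<open>Discrete Fourier forms\<close>

lemma mconst_sum: "mconst (sum f A) = (\<Sum>a\<in>A. mconst (f a))"
  by (induction A rule: infinite_finite_induct) simp_all

lemma mconst_power: "mconst (c ^ k) = mconst c ^ k"
  by (induction k) simp_all

lemma mconst_of_nat: "mconst (of_nat k) = of_nat k"
  by (induction k) simp_all

lemma primitive_root_of_unity_orthogonality:
  assumes "primitive_root_of_unity n \<zeta>"
  shows "(\<Sum>j<n. \<zeta> ^ (t * j)) = (if n dvd t then of_nat n else 0)"
proof (cases "n dvd t")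
  case True
  then obtain c where "t = n * c" by (elim dvdE)
  then have "\<zeta> ^ (t * j) = 1" for j
    using assms by (simp add: primitive_root_of_unity_def mult.assoc power_mult)
  then show ?thesis using True by simp
next
  case False
  have n: "n > 0" "\<zeta> ^ n = 1" using assms by (auto simp: primitive_root_of_unity_def)
  have "\<zeta> ^ t = \<zeta> ^ (n * (t div n) + t mod n)" by simp
  also have "\<dots> = \<zeta> ^ (t mod n)" by (simp only: power_add power_mult n) simp
  finally have "\<zeta> ^ t = \<zeta> ^ (t mod n)" .
  moreover have "0 < t mod n" "t mod n < n" using False n by (auto simp: dvd_eq_mod_eq_0)
  ultimately have ne: "\<zeta> ^ t \<noteq> 1"
    using assms by (auto simp: primitive_root_of_unity_def)
  have "(\<zeta> ^ t) ^ n = (\<zeta> ^ n) ^ t" by (simp only: mult.commute flip: power_mult)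
  then have "(\<zeta> ^ t) ^ n = 1" using n by simp
  then show ?thesis
    using ne False by (simp add: power_mult geometric_sum)
qed

lemma primitive_root_of_unity_power:
  assumes "primitive_root_of_unity (d * N) \<zeta>"
  shows "primitive_root_of_unity d (\<zeta> ^ N)"
proof -
  have pos: "d > 0" "N > 0" using assms by (auto simp: primitive_root_of_unity_def)
  have "(\<zeta> ^ N) ^ k \<noteq> 1" if "0 < k" "k < d" for k
    using assms that pos by (auto simp: primitive_root_of_unity_def mult.commute simp flip: power_mult)
  then show ?thesis
    using assms pos by (auto simp: primitive_root_of_unity_def mult.commute simp flip: power_mult)
qed

definition fourier_form :: "nat \<Rightarrow> complex \<Rightarrow> nat \<Rightarrow> nat mpoly" where
  "fourier_form n \<zeta> a = (\<Sum>m<n. mconst (\<zeta> ^ (a * m)) * mvar m)"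

text \<open>
  The \<open>k\<close>-th eigenvalue of the circulant matrix is \<open>\<Sum>j<d. \<zeta>^((n/d) k j) y\<^sub>i\<^sub>,\<^sub>j\<close>. Since \<open>\<zeta>\<^sup>n = 1\<close>, the
  factor \<open>\<zeta>^((n/d) k j)\<close> may be replaced by \<open>\<zeta>^((n/d) k m)\<close> in front of every \<open>x\<^sub>m\<close> with
  \<open>m \<equiv> j\<close> modulo \<open>d\<close>, and the double sum over \<open>j\<close> and \<open>l\<close> becomes a single Fourier form.
\<close>

lemma Theta_y_eq_prod_fourier_form:
  assumes prim: "primitive_root_of_unity n \<zeta>" and "d dvd n"
  shows "Theta_y n \<zeta> d i = (\<Prod>k<d. fourier_form n \<zeta> (i + n div d * k))"
proof -
  obtain N where N: "n = d * N" using assms(2) by (elim dvdE)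
  have pos: "d > 0" "N > 0" and zn: "\<zeta> ^ n = 1"
    using prim N by (auto simp: primitive_root_of_unity_def)
  have div: "n div d = N" using N pos by simp
  define \<omega> :: "nat mpoly" where "\<omega> = mconst (\<zeta> ^ N)"
  have prim_d: "primitive_root_of_unity d (\<zeta> ^ N)"
    using prim N primitive_root_of_unity_power by simp
  have "circulant_det d (yform n \<zeta> d i) = (\<Prod>k<d. \<Sum>j<d. \<omega> ^ (k * j) * yform n \<zeta> d i j)"
  proof (rule circulant_det_eq_prod)
    show "\<omega> ^ d = 1"
      using prim_d by (simp add: \<omega>_def primitive_root_of_unity_def flip: mconst_power)
    show "(\<Sum>j<d. \<omega> ^ (t * j)) = (if d dvd t then of_nat d else 0)" for t
      using primitive_root_of_unity_orthogonality[OF prim_d, of t, THEN arg_cong[where f = mconst]]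
      by (simp add: mconst_sum mconst_power \<omega>_def mconst_of_nat split: if_splits)
    show "of_nat d * (mconst (1 / of_nat d) :: nat mpoly) = 1"
      using pos by (simp del: mconst_simps(4) add: mconst_simps(4)[symmetric] flip: mconst_of_nat)
  qed
  also have "\<dots> = (\<Prod>k<d. fourier_form n \<zeta> (i + n div d * k))"
  proof (rule prod.cong[OF refl])
    fix k
    have per: "\<zeta> ^ (N * k * j) * \<zeta> ^ (i * (j + d * l)) = \<zeta> ^ ((i + N * k) * (j + d * l))" for j l
    proof -
      have "(i + N * k) * (j + d * l) = N * k * j + i * (j + d * l) + n * (k * l)"
        by (simp add: N algebra_simps)
      then show ?thesis by (simp only: power_add power_mult[of _ n] zn) simp
    qed
    have "(\<Sum>j<d. \<omega> ^ (k * j) * yform n \<zeta> d i j) =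
        (\<Sum>j<d. \<Sum>l<N. mconst (\<zeta> ^ ((i + N * k) * (j + d * l))) * mvar (j + d * l))"
      unfolding yform_def div sum_distrib_left \<omega>_def per[symmetric]
      by (simp only: mconst_simps mconst_power[symmetric] power_mult[symmetric] mult.assoc)
    also have "\<dots> = fourier_form n \<zeta> (i + n div d * k)"
      unfolding fourier_form_def div
      by (subst sum.group_by_residue[where g =
            "\<lambda>m. mconst (\<zeta> ^ ((i + N * k) * m)) * mvar m"]) (simp add: N)
    finally show "(\<Sum>j<d. \<omega> ^ (k * j) * yform n \<zeta> d i j) = fourier_form n \<zeta> (i + n div d * k)" .
  qed
  finally show ?thesis by (simp add: Theta_y_def)
qed

lemma mpoly_subst_prod: "mpoly_subst g (prod F A) = (\<Prod>a\<in>A. mpoly_subst g (F a))"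
  using mpoly_subst_mconst[of g 1]
  by (induction A rule: infinite_finite_induct) (simp_all add: mpoly_subst_mult)

lemma mpoly_subst_power: "mpoly_subst g (f ^ k) = mpoly_subst g f ^ k"
  using mpoly_subst_prod[of g "\<lambda>_. f" "{..<k}"] by simp

lemma mpoly_subst_mpoly_subst:
  "mpoly_subst h (mpoly_subst g f) = mpoly_subst (\<lambda>v. mpoly_subst h (g v)) f"
  unfolding mpoly_subst_def[of g] mpoly_subst_def[of "\<lambda>v. mpoly_subst h (g v)"] subst_monom_def
  by (simp add: mpoly_subst_sum mpoly_subst_mult mpoly_subst_mconst mpoly_subst_prod
      mpoly_subst_power)

lemma mpoly_subst_cong:
  assumes "f \<in> carrier (poly_ring V)" and "\<And>v. v \<in> V \<Longrightarrow> g v = h v"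
  shows "mpoly_subst g f = mpoly_subst h f"
proof -
  have "g v = h v" if "v \<in> Poly_Mapping.keys m" "m \<in> Poly_Mapping.keys f" for v m
    using that assms by (auto simp: poly_ring_sel)
  then show ?thesis by (simp add: mpoly_subst_def subst_monom_def)
qed

text \<open>The inverse discrete Fourier transform; \<open>\<zeta>\<^sup>n\<^sup>-\<^sup>b\<close> is the inverse of \<open>\<zeta>\<^sup>b\<close>.\<close>

definition fourier_inverse :: "nat \<Rightarrow> complex \<Rightarrow> nat \<Rightarrow> nat mpoly" where
  "fourier_inverse n \<zeta> m = (\<Sum>b<n. mconst (\<zeta> ^ ((n - b) * m) / of_nat n) * mvar b)"

lemma mpoly_subst_fourier_inverse:
  assumes prim: "primitive_root_of_unity n \<zeta>" and "a < n"
  shows "mpoly_subst (fourier_inverse n \<zeta>) (fourier_form n \<zeta> a) = mvar a"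
proof -
  have "mpoly_subst (fourier_inverse n \<zeta>) (fourier_form n \<zeta> a) =
      (\<Sum>m<n. \<Sum>b<n. mconst (\<zeta> ^ (a * m) * (\<zeta> ^ ((n - b) * m) / of_nat n)) * mvar b)"
    unfolding fourier_form_def
    by (simp add: mpoly_subst_sum mpoly_subst_mult mpoly_subst_mconst mpoly_subst_mvar
        fourier_inverse_def sum_distrib_left mult.assoc del: times_divide_eq_right)
  also have "\<dots> = (\<Sum>b<n. mconst ((\<Sum>m<n. \<zeta> ^ ((a + (n - b)) * m)) / of_nat n) * mvar b)"
    by (subst sum.swap) (simp only: mconst_sum sum_distrib_right sum_divide_distrib
        add_mult_distrib power_add times_divide_eq_right)
  also have "\<dots> = (\<Sum>b<n. if b = a then mvar b else 0)"
  proof (rule sum.cong[OF refl])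
    fix b assume "b \<in> {..<n}"
    then have b: "b < n" by simp
    have "n dvd a + (n - b) \<longleftrightarrow> b = a"
    proof
      assume "n dvd a + (n - b)"
      then obtain c where c: "a + (n - b) = n * c" by (elim dvdE)
      have "0 < n * c" "n * c < n * 2" using c b \<open>a < n\<close> by linarith+
      then have "c = 1" by simp
      then show "b = a" using c b by simp
    qed (use b in simp)
    then show "mconst ((\<Sum>m<n. \<zeta> ^ ((a + (n - b)) * m)) / of_nat n) * mvar b =
        (if b = a then mvar b else 0)"
      using b by (simp add: primitive_root_of_unity_orthogonality[OF prim])
  qed
  also have "\<dots> = mvar a" using \<open>a < n\<close> by simp
  finally show ?thesis .
qed


section \<open>Substituting monomials for variables\<close>

definition monom_map :: "('v \<Rightarrow> ('w \<Rightarrow>\<^sub>0 nat)) \<Rightarrow> ('v \<Rightarrow>\<^sub>0 nat) \<Rightarrow> ('w \<Rightarrow>\<^sub>0 nat)" where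
  "monom_map h m = (\<Sum>v\<in>Poly_Mapping.keys m. \<Sum>_<Poly_Mapping.lookup m v. h v)"

lemma prod_single_one:
  "(\<Prod>a\<in>A. Poly_Mapping.single (f a) 1) = (Poly_Mapping.single (sum f A) 1 :: 'v mpoly)"
  by (induction A rule: infinite_finite_induct) (simp_all add: mult_single)

lemma single_one_power:
  "(Poly_Mapping.single a 1 :: 'v mpoly) ^ k = Poly_Mapping.single (\<Sum>_<k. a) 1"
  using prod_single_one[of "\<lambda>_. a" "{..<k}"] by simp

lemma mpoly_subst_monomials:
  "mpoly_subst (\<lambda>v. Poly_Mapping.single (h v) 1) f =
     (\<Sum>m\<in>Poly_Mapping.keys f. Poly_Mapping.single (monom_map h m) (Poly_Mapping.lookup f m))"
  unfolding mpoly_subst_def subst_monom_def single_one_power prod_single_one monom_map_def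
  by (simp add: mconst_def mult_single)

text \<open>
  Distinct monomials are linearly independent, so no cancellation occurs in the image of \<open>f\<close> if the
  substitution separates the monomials of \<open>f\<close>.
\<close>

lemma mpoly_subst_monomials_eq_0_imp:
  assumes inj: "inj_on (monom_map h) (Poly_Mapping.keys f)"
    and zero: "mpoly_subst (\<lambda>v. Poly_Mapping.single (h v) 1) f = 0"
  shows "f = 0"
proof (rule ccontr)
  assume "f \<noteq> 0"
  then obtain m where m: "m \<in> Poly_Mapping.keys f"
    by (metis keys_eq_empty all_not_in_conv)
  have "0 = Poly_Mapping.lookup (mpoly_subst (\<lambda>v. Poly_Mapping.single (h v) 1) f) (monom_map h m)"
    by (simp add: zero)
  also have "\<dots> = (\<Sum>m'\<in>Poly_Mapping.keys f. Poly_Mapping.lookup f m' when m' = m)"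
    unfolding mpoly_subst_monomials lookup_sum lookup_single
    using inj m by (intro sum.cong refl arg_cong2[where f = "(when)"]) (auto dest: inj_onD)
  also have "\<dots> = Poly_Mapping.lookup f m"
    using m by (simp add: when_def)
  finally show False using m by (simp add: in_keys_iff)
qed

lemma lookup_monom_map:
  assumes "finite V" "Poly_Mapping.keys m \<subseteq> V"
  shows "Poly_Mapping.lookup (monom_map h m) x =
    (\<Sum>v\<in>V. Poly_Mapping.lookup m v * Poly_Mapping.lookup (h v) x)"
proof -
  have "Poly_Mapping.lookup (monom_map h m) x =
      (\<Sum>v\<in>Poly_Mapping.keys m. Poly_Mapping.lookup m v * Poly_Mapping.lookup (h v) x)"
    by (simp add: monom_map_def lookup_sum)
  also have "\<dots> = (\<Sum>v\<in>V. Poly_Mapping.lookup m v * Poly_Mapping.lookup (h v) x)"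
    using assms by (intro sum.mono_neutral_left) (auto simp: in_keys_iff)
  finally show ?thesis .
qed

lemma lookup_sum_single_one:
  assumes "finite A" "inj_on f A"
  shows "Poly_Mapping.lookup (\<Sum>a\<in>A. Poly_Mapping.single (f a) (1 :: nat)) v = of_bool (v \<in> f ` A)"
proof -
  have "Poly_Mapping.lookup (\<Sum>a\<in>A. Poly_Mapping.single (f a) (1 :: nat)) v =
      (\<Sum>b\<in>f ` A. if b = v then 1 else 0)"
    unfolding lookup_sum lookup_single when_def sum.reindex[OF assms(2)] o_def ..
  then show ?thesis using assms(1) by simp
qed


section \<open>The monomial form of the homomorphisms\<close>

text \<open>
  The exponent of the product of the variables whose index lies in the residue class of \<open>i\<close> modulo
  \<open>M\<close> and below \<open>M * d\<close>.
\<close>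

definition coset_monom :: "nat \<Rightarrow> nat \<Rightarrow> nat \<Rightarrow> (nat \<Rightarrow>\<^sub>0 nat)" where
  "coset_monom M d i = (\<Sum>k<d. Poly_Mapping.single (i + M * k) 1)"

lemma lookup_coset_monom:
  assumes "i < M" "x < M * d"
  shows "Poly_Mapping.lookup (coset_monom M d i) x = of_bool (x mod M = i)"
proof -
  have "x \<in> (\<lambda>k. i + M * k) ` {..<d} \<longleftrightarrow> x mod M = i"
  proof
    assume "x mod M = i"
    then have "x = i + M * (x div M)" using mod_mult_div_eq[of x M] by simp
    moreover have "x div M < d" using assms by (simp add: less_mult_imp_div_less mult.commute)
    ultimately show "x \<in> (\<lambda>k. i + M * k) ` {..<d}" by auto
  qed (use assms in auto)
  moreover have "inj_on (\<lambda>k. i + M * k) {..<d}" using assms by (auto intro: inj_onI)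
  ultimately show ?thesis unfolding coset_monom_def by (subst lookup_sum_single_one) simp_all
qed

lemma Theta_y_in_fourier_coordinates:
  assumes prim: "primitive_root_of_unity n \<zeta>" and "d dvd n" and i: "i < n div d"
  shows "mpoly_subst (fourier_inverse n \<zeta>) (Theta_y n \<zeta> d i) =
    Poly_Mapping.single (coset_monom (n div d) d i) 1"
proof -
  have "i + n div d * k < n" if "k < d" for k
  proof -
    have "i + n div d * k < n div d * Suc k" using i by simp
    also have "\<dots> \<le> n div d * d" using that by (intro mult_le_mono) auto
    also have "\<dots> = n" using \<open>d dvd n\<close> by simp
    finally show ?thesis .
  qed
  then have "mpoly_subst (fourier_inverse n \<zeta>) (Theta_y n \<zeta> d i) =
      (\<Prod>k<d. mvar (i + n div d * k))"
    unfolding Theta_y_eq_prod_fourier_form[OF prim \<open>d dvd n\<close>] mpoly_subst_prod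
    by (intro prod.cong refl mpoly_subst_fourier_inverse[OF prim]) simp
  also have "\<dots> = Poly_Mapping.single (coset_monom (n div d) d i) 1"
    unfolding mvar_def prod_single_one coset_monom_def ..
  finally show ?thesis .
qed

text \<open>
  In Fourier coordinates the exponent of the \<open>i\<close>-th coordinate, for \<open>i < n/p\<close>, in the image of a
  monomial is the exponent of \<open>z\<^sub>i\<close> itself: these coordinates represent the residue classes.
\<close>

lemma rho_eq_0_imp:
  assumes prim: "primitive_root_of_unity n \<zeta>" and "p dvd n"
    and f: "f \<in> carrier (poly_ring {..<n div p})" and zero: "rho n \<zeta> p f = 0"
  shows "f = 0"
proof (rule mpoly_subst_monomials_eq_0_imp[where h = "coset_monom (n div p) p"])
  have "mpoly_subst (fourier_inverse n \<zeta>) (rho n \<zeta> p f) =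
      mpoly_subst (\<lambda>i. Poly_Mapping.single (coset_monom (n div p) p i) 1) f"
    unfolding rho_def mpoly_subst_mpoly_subst
    by (rule mpoly_subst_cong[OF f]) (simp add: Theta_y_in_fourier_coordinates[OF prim \<open>p dvd n\<close>])
  then show "mpoly_subst (\<lambda>i. Poly_Mapping.single (coset_monom (n div p) p i) 1) f = 0"
    by (simp add: zero mpoly_subst_zero)
next
  have "n > 0" using prim by (simp add: primitive_root_of_unity_def)
  then have "p > 0" using \<open>p dvd n\<close> by (auto intro: Nat.gr0I)
  have exponent: "Poly_Mapping.lookup (monom_map (coset_monom (n div p) p) m) i = Poly_Mapping.lookup m i"
    if "m \<in> Poly_Mapping.keys f" "i < n div p" for m i
  proof -
    have "Poly_Mapping.keys m \<subseteq> {..<n div p}" using f that by (auto simp: poly_ring_sel)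
    moreover have "i < n div p * p"
      using less_le_trans[OF that(2), of "n div p * p"] \<open>p > 0\<close> by simp
    ultimately show ?thesis
      using that by (simp add: lookup_monom_map[of "{..<n div p}"] lookup_coset_monom of_bool_def
          if_distrib[of "(*) _"] cong: if_cong)
  qed
  show "inj_on (monom_map (coset_monom (n div p) p)) (Poly_Mapping.keys f)"
  proof (intro inj_onI poly_mapping_eqI)
    fix m m' i
    assume m: "m \<in> Poly_Mapping.keys f" "m' \<in> Poly_Mapping.keys f"
      and eq: "monom_map (coset_monom (n div p) p) m = monom_map (coset_monom (n div p) p) m'"
    show "Poly_Mapping.lookup m i = Poly_Mapping.lookup m' i"
    proof (cases "i < n div p")
      case True
      then show ?thesis using exponent[OF m(1)] exponent[OF m(2)] eq by simp
    next
      case False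
      then have "i \<notin> Poly_Mapping.keys m" "i \<notin> Poly_Mapping.keys m'"
        using m f by (auto simp: poly_ring_sel)
      then show ?thesis by (simp add: in_keys_iff)
    qed
  qed
qed

definition zw_monom :: "nat \<Rightarrow> nat \<Rightarrow> nat \<Rightarrow> zw \<Rightarrow> (nat \<Rightarrow>\<^sub>0 nat)" where
  "zw_monom n p q v =
     (case v of Z i \<Rightarrow> coset_monom (n div p) p i | W j \<Rightarrow> coset_monom (n div q) q j)"

lemma rho'_in_fourier_coordinates:
  assumes prim: "primitive_root_of_unity n \<zeta>" and "p dvd n" "q dvd n"
    and f: "f \<in> carrier (poly_ring (zw_vars n p q))"
  shows "mpoly_subst (fourier_inverse n \<zeta>) (rho' n \<zeta> p q f) =
    mpoly_subst (\<lambda>v. Poly_Mapping.single (zw_monom n p q v) 1) f"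
  unfolding rho'_def mpoly_subst_mpoly_subst
  by (rule mpoly_subst_cong[OF f])
    (auto simp: zw_monom_def zw_vars_def Theta_y_in_fourier_coordinates[OF prim] assms)

lemma lookup_monom_map_zw_monom:
  assumes "p dvd n" "q dvd n" "x < n" and m: "Poly_Mapping.keys m \<subseteq> zw_vars n p q"
  shows "Poly_Mapping.lookup (monom_map (zw_monom n p q) m) x =
    Poly_Mapping.lookup m (Z (x mod (n div p))) + Poly_Mapping.lookup m (W (x mod (n div q)))"
proof -
  have pos: "n div p > 0" "n div q > 0"
    using assms(1-3) by (auto simp: div_greater_zero_iff intro!: dvd_imp_le Nat.gr0I)
  have "Poly_Mapping.lookup (monom_map (zw_monom n p q) m) x =
      (\<Sum>v\<in>zw_vars n p q. Poly_Mapping.lookup m v * Poly_Mapping.lookup (zw_monom n p q v) x)"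
    by (rule lookup_monom_map[OF _ m]) (simp add: zw_vars_def)
  also have "\<dots> =
      (\<Sum>i<n div p. Poly_Mapping.lookup m (Z i) * Poly_Mapping.lookup (coset_monom (n div p) p i) x) +
      (\<Sum>j<n div q. Poly_Mapping.lookup m (W j) * Poly_Mapping.lookup (coset_monom (n div q) q j) x)"
    unfolding zw_vars_def
    by (subst sum.union_disjoint) (auto simp: sum.reindex inj_on_def zw_monom_def)
  also have "\<dots> =
      (\<Sum>i<n div p. Poly_Mapping.lookup m (Z i) * of_bool (x mod (n div p) = i)) +
      (\<Sum>j<n div q. Poly_Mapping.lookup m (W j) * of_bool (x mod (n div q) = j))"
    using assms(1-3) by (intro arg_cong2[where f = "(+)"] sum.cong refl) (auto simp: lookup_coset_monom)
  finally show ?thesis using pos by (simp add: of_bool_def if_distrib[of "(*) _"] cong: if_cong)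
qed


section \<open>Normal monomials\<close>

text \<open>
  A monomial is normal if it is divisible by the first term \<open>\<Prod>j<q. z (c + N j)\<close> of no relation
  \<open>t\<^sub>c\<close>.
\<close>

definition normal_monom :: "nat \<Rightarrow> nat \<Rightarrow> (zw \<Rightarrow>\<^sub>0 nat) \<Rightarrow> bool" where
  "normal_monom N q m \<longleftrightarrow> (\<forall>c<N. \<exists>j<q. Poly_Mapping.lookup m (Z (c + N * j)) = 0)"

text \<open>
  Writing an array as a sum of a row function and a column function is unique up to moving a
  constant between the two. Requiring the natural-number valued \<open>\<alpha>\<close> to vanish somewhere fixes that
  constant: where \<open>\<alpha>\<close> is 0, the equation gives \<open>\<beta>' b \<le> \<beta> b\<close>, and symmetrically.
\<close>

lemma row_plus_column_unique:
  fixes \<alpha> \<alpha>' :: "'a \<Rightarrow> nat" and \<beta> \<beta>' :: "'b \<Rightarrow> nat"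
  assumes eq: "\<And>a b. a \<in> A \<Longrightarrow> b \<in> B \<Longrightarrow> \<alpha> a + \<beta> b = \<alpha>' a + \<beta>' b"
    and "\<exists>a\<in>A. \<alpha> a = 0" "\<exists>a\<in>A. \<alpha>' a = 0" "B \<noteq> {}"
  shows "(\<forall>a\<in>A. \<alpha> a = \<alpha>' a) \<and> (\<forall>b\<in>B. \<beta> b = \<beta>' b)"
proof -
  obtain a a' where a: "a \<in> A" "\<alpha> a = 0" "a' \<in> A" "\<alpha>' a' = 0" using assms by blast
  have \<beta>: "\<beta> b = \<beta>' b" if "b \<in> B" for b
    using eq[OF a(1) that] eq[OF a(3) that] a by simp
  moreover have "\<alpha> x = \<alpha>' x" if "x \<in> A" for x
    using eq[OF that] \<beta> \<open>B \<noteq> {}\<close> by fastforce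
  ultimately show ?thesis by blast
qed

text \<open>
  The residue classes modulo \<open>N\<close> split the indices below \<open>n\<close> into \<open>q\<close> by \<open>p\<close> grids, and in each of
  them the exponents of the image are row exponents plus column exponents.
\<close>

lemma inj_on_monom_map_zw_monom:
  assumes "N > 0" "p > 0" "q > 0" "coprime p q" and n: "n = p * q * N"
  shows "inj_on (monom_map (zw_monom n p q))
    {m. Poly_Mapping.keys m \<subseteq> zw_vars n p q \<and> normal_monom N q m}"
proof (intro inj_onI)
  fix m m' :: "zw \<Rightarrow>\<^sub>0 nat"
  assume "m \<in> {m. Poly_Mapping.keys m \<subseteq> zw_vars n p q \<and> normal_monom N q m}"
    and "m' \<in> {m. Poly_Mapping.keys m \<subseteq> zw_vars n p q \<and> normal_monom N q m}"
  then have m: "Poly_Mapping.keys m \<subseteq> zw_vars n p q" "normal_monom N q m"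
    and m': "Poly_Mapping.keys m' \<subseteq> zw_vars n p q" "normal_monom N q m'" by auto
  assume eq: "monom_map (zw_monom n p q) m = monom_map (zw_monom n p q) m'"
  have div: "n div p = N * q" "n div q = N * p"
    using assms by (simp_all add: mult.commute mult.left_commute)
  have dvd: "p dvd n" "q dvd n" by (simp_all add: n)
  \<comment> \<open>The Chinese remainder theorem finds the index \<open>c + N k\<close> in row \<open>a\<close> and column \<open>b\<close>.\<close>
  have grid: "Poly_Mapping.lookup m (Z (c + N * a)) + Poly_Mapping.lookup m (W (c + N * b)) =
      Poly_Mapping.lookup m' (Z (c + N * a)) + Poly_Mapping.lookup m' (W (c + N * b))"
    if "c < N" "a < q" "b < p" for a b c
  proof -
    obtain k where k: "k < p * q" "[k = b] (mod p)" "[k = a] (mod q)"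
      using binary_chinese_remainder_unique_nat[OF \<open>coprime p q\<close>, of b a] assms by auto
    define x where "x = c + N * k"
    have "x < N * Suc k" using \<open>c < N\<close> by (simp add: x_def)
    also have "\<dots> \<le> N * (p * q)" using k by (intro mult_le_mono) auto
    finally have "x < n" by (simp add: n mult.commute)
    have "x mod (N * q) = c + N * a" "x mod (N * p) = c + N * b"
      using that k by (simp_all add: x_def mod_mult2_eq cong_def)
    then show ?thesis
      using lookup_monom_map_zw_monom[OF dvd \<open>x < n\<close> m(1)]
        lookup_monom_map_zw_monom[OF dvd \<open>x < n\<close> m'(1)] eq by (simp add: div)
  qed
  have block: "(\<forall>a\<in>{..<q}. Poly_Mapping.lookup m (Z (c + N * a)) = Poly_Mapping.lookup m' (Z (c + N * a))) \<and>
      (\<forall>b\<in>{..<p}. Poly_Mapping.lookup m (W (c + N * b)) = Poly_Mapping.lookup m' (W (c + N * b)))"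
    if "c < N" for c
    by (rule row_plus_column_unique)
      (use that grid m(2) m'(2) \<open>p > 0\<close> in \<open>auto simp: normal_monom_def\<close>)
  have Z_eq: "Poly_Mapping.lookup m (Z i) = Poly_Mapping.lookup m' (Z i)" if "i < N * q" for i
  proof -
    have "i mod N < N" "i div N < q" using that \<open>N > 0\<close>
      by (simp_all add: less_mult_imp_div_less mult.commute)
    then show ?thesis using block[of "i mod N", THEN conjunct1, THEN bspec, of "i div N"] by simp
  qed
  have W_eq: "Poly_Mapping.lookup m (W j) = Poly_Mapping.lookup m' (W j)" if "j < N * p" for j
  proof -
    have "j mod N < N" "j div N < p" using that \<open>N > 0\<close>
      by (simp_all add: less_mult_imp_div_less mult.commute)
    then show ?thesis using block[of "j mod N", THEN conjunct2, THEN bspec, of "j div N"] by simp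
  qed
  show "m = m'"
  proof (rule poly_mapping_eqI)
    fix v
    show "Poly_Mapping.lookup m v = Poly_Mapping.lookup m' v"
    proof (cases "v \<in> zw_vars n p q")
      case True
      then show ?thesis using Z_eq W_eq by (auto simp: zw_vars_def div)
    next
      case False
      then have "v \<notin> Poly_Mapping.keys m" "v \<notin> Poly_Mapping.keys m'" using m m' by auto
      then show ?thesis by (simp add: in_keys_iff)
    qed
  qed
qed


section \<open>The ideal of relations\<close>

text \<open>
  Both terms of the binomial \<open>t\<^sub>c\<close> have this exponent, with \<open>V = Z\<close>, \<open>d = q\<close> and \<open>V = W\<close>, \<open>d = p\<close>.
\<close>

definition relation_term :: "nat \<Rightarrow> nat \<Rightarrow> (nat \<Rightarrow> zw) \<Rightarrow> nat \<Rightarrow> (zw \<Rightarrow>\<^sub>0 nat)" where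
  "relation_term N d V c = (\<Sum>j<d. Poly_Mapping.single (V (c + N * j)) 1)"

lemma trel_eq:
  "trel n p q c = Poly_Mapping.single (relation_term (n div (p * q)) q Z c) 1 -
     Poly_Mapping.single (relation_term (n div (p * q)) p W c) 1"
  unfolding trel_def mvar_def prod_single_one relation_term_def ..

lemma lookup_relation_term:
  assumes "N > 0" "inj V"
  shows "Poly_Mapping.lookup (relation_term N d V c) v = of_bool (v \<in> (\<lambda>j. V (c + N * j)) ` {..<d})"
  unfolding relation_term_def
proof (rule lookup_sum_single_one)
  show "inj_on (\<lambda>j. V (c + N * j)) {..<d}"
    using assms(1) by (intro inj_onI) (drule injD[OF assms(2)], simp)
qed simp

lemma keys_relation_term_subset:
  assumes "c < N"
  shows "Poly_Mapping.keys (relation_term N d V c) \<subseteq> V ` {..<N * d}"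
proof -
  have "c + N * j < N * d" if "j < d" for j
  proof -
    have "c + N * j < N * Suc j" using assms by simp
    also have "\<dots> \<le> N * d" using that by (intro mult_le_mono) auto
    finally show ?thesis .
  qed
  then show ?thesis
    unfolding relation_term_def by (intro subset_trans[OF keys_sum]) auto
qed

lemma trel_in_carrier:
  assumes "p > 0" "q > 0" "p * q dvd n" "c < n div (p * q)"
  shows "trel n p q c \<in> carrier (poly_ring (zw_vars n p q))"
proof -
  have div: "n div p = n div (p * q) * q" "n div q = n div (p * q) * p"
    using assms by (auto elim!: dvdE)
  have "Poly_Mapping.keys (relation_term (n div (p * q)) q Z c) \<subseteq> zw_vars n p q"
    using keys_relation_term_subset[OF assms(4), of q Z] unfolding zw_vars_def div by blast
  moreover have "Poly_Mapping.keys (relation_term (n div (p * q)) p W c) \<subseteq> zw_vars n p q"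
    using keys_relation_term_subset[OF assms(4), of p W] unfolding zw_vars_def div by blast
  ultimately have "Poly_Mapping.keys m \<subseteq> zw_vars n p q"
    if "m \<in> Poly_Mapping.keys (trel n p q c)" for m
    using subsetD[OF keys_diff that[unfolded trel_eq]] by auto
  then show ?thesis by (simp add: poly_ring_sel)
qed

text \<open>
  Both terms of \<open>t\<^sub>c\<close> are mapped to the product of the Fourier forms over the whole residue class of
  \<open>c\<close> modulo \<open>N\<close>, grouped once by rows and once by columns.
\<close>

lemma rho'_trel:
  assumes prim: "primitive_root_of_unity n \<zeta>" and "p > 0" "q > 0" and dvd: "p * q dvd n"
  shows "rho' n \<zeta> p q (trel n p q c) = 0"
proof -
  define N where "N = n div (p * q)"
  have div: "n div p = N * q" "n div q = N * p" and "p dvd n" "q dvd n"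
    using assms by (auto simp: N_def elim!: dvdE)
  let ?g = "\<lambda>v. case v of Z i \<Rightarrow> Theta_y n \<zeta> p i | W j \<Rightarrow> Theta_y n \<zeta> q j"
  have row: "(\<Prod>j<d. Theta_y n \<zeta> e (c + N * j)) = (\<Prod>k<d * e. fourier_form n \<zeta> (c + N * k))"
    if "e dvd n" "n div e = N * d" for d e
    unfolding Theta_y_eq_prod_fourier_form[OF prim \<open>e dvd n\<close>] that(2)
    using prod.group_by_residue[of "\<lambda>k. fourier_form n \<zeta> (c + N * k)" d e]
    by (simp add: algebra_simps)
  have "rho' n \<zeta> p q (trel n p q c) + mpoly_subst ?g (\<Prod>j<p. mvar (W (c + N * j))) =
      mpoly_subst ?g (\<Prod>j<q. mvar (Z (c + N * j)))"
    unfolding rho'_def by (simp add: trel_def N_def flip: mpoly_subst_add)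
  moreover have "mpoly_subst ?g (\<Prod>j<p. mvar (W (c + N * j))) =
      mpoly_subst ?g (\<Prod>j<q. mvar (Z (c + N * j)))"
    using row[OF \<open>p dvd n\<close> div(1)] row[OF \<open>q dvd n\<close> div(2)]
    by (simp add: mpoly_subst_prod mpoly_subst_mvar mult.commute)
  ultimately show ?thesis by simp
qed

text \<open>
  While a monomial is divisible by the \<open>z\<close>-term of some \<open>t\<^sub>c\<close>, replacing that term by the \<open>w\<close>-term
  changes it by an element of the ideal and lowers its degree in the \<open>z\<close>-variables; so the rewriting
  stops, at a normal monomial.
\<close>

lemma normal_monom_mod_ideal:
  assumes "q > 0" and N: "N = n div (p * q)" "N > 0"
    and div: "n div p = N * q" "n div q = N * p"
    and J: "ideal J (poly_ring (zw_vars n p q))" and rel: "trel n p q ` {..<N} \<subseteq> J"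
    and "Poly_Mapping.keys m \<subseteq> zw_vars n p q"
  shows "\<exists>m'. Poly_Mapping.keys m' \<subseteq> zw_vars n p q \<and> normal_monom N q m' \<and>
    Poly_Mapping.single m 1 - Poly_Mapping.single m' 1 \<in> J"
  using \<open>Poly_Mapping.keys m \<subseteq> zw_vars n p q\<close>
proof (induction "\<Sum>i<N * q. Poly_Mapping.lookup m (Z i)" arbitrary: m rule: less_induct)
  case less
  interpret ideal J "poly_ring (zw_vars n p q)" by (rule J)
  show ?case
  proof (cases "normal_monom N q m")
    case True
    then show ?thesis using less.prems additive_subgroup.zero_closed[OF additive_subgroup_axioms]
      by (intro exI[of _ m]) (simp add: poly_ring_sel)
  next
    case False
    then obtain c where c: "c < N" and full: "\<And>j. j < q \<Longrightarrow> Poly_Mapping.lookup m (Z (c + N * j)) \<noteq> 0"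
      by (auto simp: normal_monom_def)
    define z where "z = relation_term N q Z c"
    define w where "w = relation_term N p W c"
    define a where "a = m - z"
    have inj: "inj Z" "inj W" by (auto intro: injI)
    have z: "Poly_Mapping.lookup z v = of_bool (v \<in> (\<lambda>j. Z (c + N * j)) ` {..<q})" for v
      unfolding z_def by (rule lookup_relation_term[OF N(2) inj(1)])
    have w: "Poly_Mapping.lookup w (Z i) = 0" for i
      unfolding w_def by (subst lookup_relation_term[OF N(2) inj(2)]) auto
    have le: "Poly_Mapping.lookup z v \<le> Poly_Mapping.lookup m v" for v
      using full unfolding z by (auto simp: Suc_le_eq)
    have m_eq: "m = a + z"
      by (rule poly_mapping_eqI) (simp add: a_def lookup_add lookup_minus le)
    have keys_a: "Poly_Mapping.keys a \<subseteq> zw_vars n p q"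
      using less.prems by (auto simp: a_def in_keys_iff lookup_minus)
    have keys_aw: "Poly_Mapping.keys (a + w) \<subseteq> zw_vars n p q"
    proof -
      have "Poly_Mapping.keys w \<subseteq> zw_vars n p q"
        using keys_relation_term_subset[OF c, of p W] unfolding w_def zw_vars_def div by blast
      then show ?thesis using keys_a keys_add[of a w] by blast
    qed
    have "(\<Sum>i<N * q. Poly_Mapping.lookup (a + w) (Z i)) < (\<Sum>i<N * q. Poly_Mapping.lookup m (Z i))"
    proof (rule sum_strict_mono_ex1)
      show "\<forall>i\<in>{..<N * q}. Poly_Mapping.lookup (a + w) (Z i) \<le> Poly_Mapping.lookup m (Z i)"
        by (simp add: lookup_add w a_def lookup_minus)
      have "Poly_Mapping.lookup z (Z c) = 1"
        using \<open>q > 0\<close> unfolding z by (auto intro!: image_eqI[of _ _ 0])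
      then have "Poly_Mapping.lookup (a + w) (Z c) < Poly_Mapping.lookup m (Z c)"
        using le[of "Z c"] by (simp add: lookup_add w a_def lookup_minus)
      moreover have "c < N * q" using less_le_trans[OF c, of "N * q"] \<open>q > 0\<close> by simp
      ultimately show "\<exists>i\<in>{..<N * q}. Poly_Mapping.lookup (a + w) (Z i) < Poly_Mapping.lookup m (Z i)"
        using c by (intro bexI[of _ c]) simp_all
    qed simp
    from less.hyps[OF this keys_aw] obtain m' where m': "Poly_Mapping.keys m' \<subseteq> zw_vars n p q"
      "normal_monom N q m'" "Poly_Mapping.single (a + w) 1 - Poly_Mapping.single m' 1 \<in> J" by blast
    have "Poly_Mapping.single a 1 * trel n p q c \<in> J"
      using I_l_closed[of "trel n p q c" "Poly_Mapping.single a 1"] rel c keys_a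
      by (auto simp: poly_ring_sel)
    also have "Poly_Mapping.single a 1 * trel n p q c =
        Poly_Mapping.single m 1 - Poly_Mapping.single (a + w) 1"
      unfolding trel_eq N(1)[symmetric] z_def[symmetric] w_def[symmetric] m_eq
      by (simp add: right_diff_distrib mult_single)
    finally have "Poly_Mapping.single m 1 - Poly_Mapping.single (a + w) 1 \<in> J" .
    from additive_subgroup.a_closed[OF additive_subgroup_axioms this m'(3)]
    have "Poly_Mapping.single m 1 - Poly_Mapping.single m' 1 \<in> J" by (simp add: poly_ring_sel(4))
    then show ?thesis using m' by blast
  qed
qed

text \<open>
  Replacing each monomial of \<open>f\<close> by a normal one gives \<open>r\<close> with \<open>f - r \<in> J\<close>. As \<open>J\<close> lies in the
  kernel, so does \<open>r\<close>, and separation of normal monomials forces \<open>r = 0\<close>.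
\<close>

lemma rho'_eq_0_imp_in_ideal:
  assumes prim: "primitive_root_of_unity n \<zeta>"
    and "p > 0" "q > 0" "coprime p q" "p * q dvd n"
    and J: "ideal J (poly_ring (zw_vars n p q))" and rel: "trel n p q ` {..<n div (p * q)} \<subseteq> J"
    and f: "f \<in> carrier (poly_ring (zw_vars n p q))" and zero: "rho' n \<zeta> p q f = 0"
    and J_ker: "\<And>g. g \<in> J \<Longrightarrow> rho' n \<zeta> p q g = 0"
  shows "f \<in> J"
proof -
  interpret ideal J "poly_ring (zw_vars n p q)" by (rule J)
  define N where "N = n div (p * q)"
  have n: "n = p * q * N" using \<open>p * q dvd n\<close> by (simp add: N_def)
  have "n > 0" using prim by (simp add: primitive_root_of_unity_def)
  then have "N > 0" by (simp add: n)
  have div: "n div p = N * q" "n div q = N * p"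
    using assms(2,3) by (simp_all add: n mult.commute mult.left_commute)
  have "p dvd n" "q dvd n" by (simp_all add: n)
  have "\<exists>nf. \<forall>m\<in>Poly_Mapping.keys f. Poly_Mapping.keys (nf m) \<subseteq> zw_vars n p q \<and>
      normal_monom N q (nf m) \<and> Poly_Mapping.single m 1 - Poly_Mapping.single (nf m) 1 \<in> J"
    using f normal_monom_mod_ideal[OF \<open>q > 0\<close> N_def \<open>N > 0\<close> div J] rel
    by (intro bchoice) (auto simp: poly_ring_sel N_def)
  then obtain nf where nf: "\<And>m. m \<in> Poly_Mapping.keys f \<Longrightarrow> Poly_Mapping.keys (nf m) \<subseteq> zw_vars n p q"
    "\<And>m. m \<in> Poly_Mapping.keys f \<Longrightarrow> normal_monom N q (nf m)"
    "\<And>m. m \<in> Poly_Mapping.keys f \<Longrightarrow> Poly_Mapping.single m 1 - Poly_Mapping.single (nf m) 1 \<in> J" by blast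
  define r where "r = (\<Sum>m\<in>Poly_Mapping.keys f. Poly_Mapping.single (nf m) (Poly_Mapping.lookup f m))"
  have sum_J: "sum h A \<in> J" if "\<And>a. a \<in> A \<Longrightarrow> h a \<in> J" for h and A :: "(zw \<Rightarrow>\<^sub>0 nat) set"
    using that additive_subgroup.zero_closed[OF additive_subgroup_axioms]
      additive_subgroup.a_closed[OF additive_subgroup_axioms]
    by (induction A rule: infinite_finite_induct) (simp_all add: poly_ring_sel(3,4))
  have scale: "mconst c * g \<in> J" if "g \<in> J" for c g
    using I_l_closed[OF that, of "mconst c"] by (simp add: poly_ring_sel mconst_def)
  have "f - r = (\<Sum>m\<in>Poly_Mapping.keys f.
      mconst (Poly_Mapping.lookup f m) * (Poly_Mapping.single m 1 - Poly_Mapping.single (nf m) 1))"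
    by (subst mpoly_as_sum[of f])
      (simp add: r_def mconst_def right_diff_distrib mult_single sum_subtractf)
  then have diff: "f - r \<in> J" using sum_J scale nf(3) by simp
  have keys_r: "Poly_Mapping.keys r \<subseteq> nf ` Poly_Mapping.keys f"
    unfolding r_def by (rule subset_trans[OF keys_sum]) auto
  have r: "r \<in> carrier (poly_ring (zw_vars n p q))"
    using keys_r nf(1) by (auto simp: poly_ring_sel)
  have "rho' n \<zeta> p q r + rho' n \<zeta> p q (f - r) = rho' n \<zeta> p q f"
    by (simp add: rho'_def flip: mpoly_subst_add)
  then have "rho' n \<zeta> p q r = 0" using J_ker[OF diff] zero by simp
  then have "mpoly_subst (\<lambda>v. Poly_Mapping.single (zw_monom n p q v) 1) r = 0"
    using rho'_in_fourier_coordinates[OF prim \<open>p dvd n\<close> \<open>q dvd n\<close> r] by (simp add: mpoly_subst_zero)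
  moreover have "inj_on (monom_map (zw_monom n p q)) (Poly_Mapping.keys r)"
    by (rule inj_on_subset[OF inj_on_monom_map_zw_monom[OF \<open>N > 0\<close> assms(2,3,4) n]])
      (use keys_r nf in auto)
  ultimately have "r = 0" by (rule mpoly_subst_monomials_eq_0_imp[rotated])
  then show ?thesis using diff by simp
qed

text \<open>
  The kernel does not depend on the codomain, so \<open>\<rho>'\<close> may be regarded here as a map into the full
  polynomial ring.
\<close>

lemma ideal_kernel_rho':
  "ideal {f \<in> carrier (poly_ring (zw_vars n p q)). rho' n \<zeta> p q f = 0} (poly_ring (zw_vars n p q))"
proof -
  let ?R = "poly_ring (zw_vars n p q)" and ?S = "poly_ring (UNIV :: nat set)"
  have R: "ring ?R" and S: "ring ?S" by (rule cring.axioms(1)[OF poly_ring_cring])+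
  have one: "rho' n \<zeta> p q 1 = 1" using rho'_mconst[of n \<zeta> p q 1] by simp
  have hom: "rho' n \<zeta> p q \<in> Ring.ring_hom ?R ?S"
  proof (rule ring_hom_memI)
    show "rho' n \<zeta> p q f \<in> carrier ?S" for f by (simp add: poly_ring_sel(5))
  qed (simp_all add: poly_ring_sel(1,2,4) one, simp_all add: rho'_def mpoly_subst_add mpoly_subst_mult)
  have "ring_hom_ring ?R ?S (rho' n \<zeta> p q)" by (rule ring_hom_ringI2[OF R S hom])
  from ring_hom_ring.kernel_is_ideal[OF this] show ?thesis
    unfolding a_kernel_def' poly_ring_sel(3) .
qed

theorem theorem2:
  fixes n p q :: nat and \<zeta> :: complex
  assumes "n > 0" and "p > 0" and "q > 0"
    and "coprime p q" and "p * q dvd n"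
    and "primitive_root_of_unity n \<zeta>"
  shows "a_kernel (poly_ring {..<n div p}) (rho_codomain n \<zeta> p) (rho n \<zeta> p) = {0} \<and>
         a_kernel (poly_ring (zw_vars n p q)) (rho'_codomain n \<zeta> p q) (rho' n \<zeta> p q) =
           Idl\<^bsub>poly_ring (zw_vars n p q)\<^esub> (trel n p q ` {..<n div (p * q)})"
proof
  have "p dvd n" using assms(5) by (rule dvd_mult_left)
  show "a_kernel (poly_ring {..<n div p}) (rho_codomain n \<zeta> p) (rho n \<zeta> p) = {0}"
    using rho_eq_0_imp[OF assms(6) \<open>p dvd n\<close>]
    by (auto simp: a_kernel_def' rho_codomain_def subalgebra_gen_def poly_ring_sel(3)
        rho_def mpoly_subst_zero poly_ring_sel(5)[of 0])
next
  let ?R = "poly_ring (zw_vars n p q)"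
  let ?T = "trel n p q ` {..<n div (p * q)}"
  let ?K = "{f \<in> carrier ?R. rho' n \<zeta> p q f = 0}"
  interpret R: cring ?R by (rule poly_ring_cring)
  have T: "?T \<subseteq> carrier ?R" using trel_in_carrier assms by blast
  have "?T \<subseteq> ?K" using T rho'_trel assms by auto
  then have le: "Idl\<^bsub>?R\<^esub> ?T \<subseteq> ?K" by (rule R.genideal_minimal[OF ideal_kernel_rho'])
  moreover have "?K \<subseteq> Idl\<^bsub>?R\<^esub> ?T"
    using rho'_eq_0_imp_in_ideal[OF assms(6,2-5) R.genideal_ideal[OF T] R.genideal_self[OF T]] le
    by blast
  ultimately show "a_kernel ?R (rho'_codomain n \<zeta> p q) (rho' n \<zeta> p q) = Idl\<^bsub>?R\<^esub> ?T"
    by (simp add: a_kernel_def' rho'_codomain_def subalgebra_gen_def poly_ring_sel(3))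
qed

end
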